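(* Let $d,M\ge1$ be integers, $q\in(0,1)$, $R_{\max},R_{\min},r,L>0$, $\varepsilon>0$, and let $A\subset\mathbb{S}^{d-1}$ with $|A|=M$. For a random vector $X$ in $\mathbb{R}^d$ let $f_A(X)=\{Q_q(\langle X,\theta\rangle)\}_{\theta\in A}\in\mathbb{R}^M$, and write $f_A(\mathcal{D})=f_A(Y)$ for $Y\sim\mathcal{D}$. Then for every $0<\alpha<\frac{\min\{r,R_{\min}\}}{2}$ there exist a positive integer $$n=\tilde O\left(\frac{d}{\alpha^2L^2}+\frac{M}{\varepsilon L\alpha}+\frac{M}{\varepsilon L\min\{r,R_{\min}\}}\right)$$ and an $\varepsilon$-differentially private algorithm $\mathcal{A}$ on $(\mathbb{R}^d)^n$ with values in $\mathbb{R}^M$ such that, for every $\mathcal{D}\in A_q(R_{\max},R_{\min},r,L)$, if $X=(X_1,\dots,X_n)$ is sampled i.i.d. from $\mathcal{D}$, then $$\mathbb{P}\left(\|\mathcal{A}(X)-f_A(\mathcal{D})\|_\infty\le\alpha\right)\ge 0.9 .$$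
   Context: **Quantiles.** For a real random variable $Y$, $Q_q(Y)=\inf\{t\in\mathbb{R}:\mathbb{P}(Y\le t)\ge q\}$. **Admissible laws.** Fix a polynomial $\mathfrak p(n,d)$. A distribution $\mathcal{D}$ on $\mathbb{R}^d$ belongs to $A_q(R_{\max},R_{\min},r,L)$ if, for $X\sim\mathcal{D}$: (1) $Q_q(\langle X,\theta\rangle)\in[-R_{\max},R_{\max}]$ for all $\theta\in\mathbb{S}^{d-1}$; (2) there is $c\in\mathbb{R}^d$ with $|Q_q(\langle X,\theta\rangle)-\langle c,\theta\rangle|\ge R_{\min}$ for all $\theta\in\mathbb{S}^{d-1}$; (3) for every $\theta\in\mathbb{S}^{d-1}$ the density $f_\theta$ of $\langle X,\theta\rangle$ exists and $f_\theta(t)\ge L$ for all $t\in[Q_q(\langle X,\theta\rangle)-r,Q_q(\langle X,\theta\rangle)+r]$; (4) if $X_1,\dots,X_n$ are i.i.d. from $\mathcal{D}$, then with high probability, namely at least $1-e^{-n}$, $\|X_i\|_2\le\mathfrak p(n,d)$ for all $i\in[n]$. **Privacy.** A randomized algorithm $\mathcal{A}$ on $(\mathbb{R}^d)^n$ is $\varepsilon$-differentially private if for all measurable subsets $S$ of the output space and all $X,X'\in(\mathbb{R}^d)^n$, $\mathbb{P}(\mathcal{A}(X)\in S)\le e^{\varepsilon d_H(X,X')}\mathbb{P}(\mathcal{A}(X')\in S)$, where $d_H(X,X')=|\{i:X_i\ne X_i'\}|$. **Asymptotic notation.** $\tilde O$ omits multiplicative constants and logarithmic factors in all parameters: $n=\tilde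 O(g)$ means $n\le C\,g\,(\log(2+\Pi))^{C}$, where $\Pi$ is the sum of all numerical parameters of the problem and their reciprocals, and $C$ depends only on the polynomial $\mathfrak p$.
   Formalization: The bound on n is read as n ≤ max(1, C·g·(log(2+Π))^C); the maximum with 1 matters only for parameters (such as very large L) for which the class A_q is empty and no positive integer n could satisfy the stated bound. *)

theory Defs
  imports "HOL-Probability.Probability" "HOL-Computational_Algebra.Polynomial"
begin

text \<open>The constant of the final sample bound is uniform in the dimension, so \<open>\<real>\<^sup>d\<close> is indexed by
  a natural number and not by a type: vectors are the extensional functions on \<open>{..<d}\<close>.\<close>

definition Rd :: "nat \<Rightarrow> (nat \<Rightarrow> real) measure" where
  "Rd d = PiM {..<d} (\<lambda>_. borel)"

definition inner_d :: "nat \<Rightarrow> (nat \<Rightarrow> real) \<Rightarrow> (nat \<Rightarrow> real) \<Rightarrow> real" where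
  "inner_d d x y = (\<Sum>i<d. x i * y i)"

definition norm_d :: "nat \<Rightarrow> (nat \<Rightarrow> real) \<Rightarrow> real" where
  "norm_d d x = L2_set x {..<d}"

definition unit_sphere :: "nat \<Rightarrow> (nat \<Rightarrow> real) set" where
  "unit_sphere d = {\<theta> \<in> space (Rd d). norm_d d \<theta> = 1}"

definition linf_norm :: "'i set \<Rightarrow> ('i \<Rightarrow> real) \<Rightarrow> real" where
  "linf_norm I v = (MAX i\<in>I. \<bar>v i\<bar>)"

definition quantile :: "'a measure \<Rightarrow> real \<Rightarrow> ('a \<Rightarrow> real) \<Rightarrow> real" where
  "quantile D q Y = Inf {t. q \<le> measure D {x \<in> space D. Y x \<le> t}}"

definition dir_quantile :: "nat \<Rightarrow> real \<Rightarrow> (nat \<Rightarrow> real) measure \<Rightarrow> (nat \<Rightarrow> real) \<Rightarrow> real" where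
  "dir_quantile d q D \<theta> = quantile D q (\<lambda>x. inner_d d x \<theta>)"

definition quantile_family ::
  "nat \<Rightarrow> real \<Rightarrow> (nat \<Rightarrow> real) set \<Rightarrow> (nat \<Rightarrow> real) measure \<Rightarrow> (nat \<Rightarrow> real) \<Rightarrow> real" where
  "quantile_family d q \<Theta> D = (\<lambda>\<theta>\<in>\<Theta>. dir_quantile d q D \<theta>)"

text \<open>Evaluation of a polynomial in two variables, the inner variable at \<open>x\<close>, the outer at \<open>y\<close>.\<close>

definition poly2 :: "real poly poly \<Rightarrow> real \<Rightarrow> real \<Rightarrow> real" where
  "poly2 P x y = poly (poly P [:y:]) x"

text \<open>An i.i.d. sample of size \<open>n\<close> from \<open>D\<close> has law \<open>PiM {..<n} (\<lambda>_. D)\<close>. Since the class does not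
  depend on a sample size, the boundedness requirement is imposed for every \<open>n\<close>. A density is only
  determined almost everywhere, so the lower bound is asked of some version of it.\<close>

definition admissible ::
  "real poly poly \<Rightarrow> nat \<Rightarrow> real \<Rightarrow> real \<Rightarrow> real \<Rightarrow> real \<Rightarrow> real \<Rightarrow> (nat \<Rightarrow> real) measure set" where
  "admissible P d q Rmax Rmin r L = {D. prob_space D \<and> sets D = sets (Rd d) \<and>
     (\<forall>\<theta>\<in>unit_sphere d. dir_quantile d q D \<theta> \<in> {-Rmax..Rmax}) \<and>
     (\<exists>c\<in>space (Rd d). \<forall>\<theta>\<in>unit_sphere d. \<bar>dir_quantile d q D \<theta> - inner_d d c \<theta>\<bar> \<ge> Rmin) \<and>
     (\<forall>\<theta>\<in>unit_sphere d. \<exists>f :: real \<Rightarrow> real. (\<forall>t. 0 \<le> f t) \<and>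
        distributed D lborel (\<lambda>x. inner_d d x \<theta>) (\<lambda>t. ennreal (f t)) \<and>
        (\<forall>t\<in>{dir_quantile d q D \<theta> - r .. dir_quantile d q D \<theta> + r}. f t \<ge> L)) \<and>
     (\<forall>n\<ge>1. measure (PiM {..<n} (\<lambda>_. D))
        {X \<in> space (PiM {..<n} (\<lambda>_. D)). \<forall>i<n. norm_d d (X i) \<le> poly2 P (real n) (real d)}
        \<ge> 1 - exp (- real n))}"

definition dataset :: "nat \<Rightarrow> nat \<Rightarrow> (nat \<Rightarrow> nat \<Rightarrow> real) measure" where
  "dataset n d = PiM {..<n} (\<lambda>_. Rd d)"

text \<open>A randomized algorithm is a Markov kernel from data sets to the output space.\<close>

definition rand_algorithm ::
  "nat \<Rightarrow> nat \<Rightarrow> 'b measure \<Rightarrow> ((nat \<Rightarrow> nat \<Rightarrow> real) \<Rightarrow> 'b measure) \<Rightarrow> bool" where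
  "rand_algorithm n d N \<A> \<longleftrightarrow> \<A> \<in> dataset n d \<rightarrow>\<^sub>M prob_algebra N"

definition hamming :: "nat \<Rightarrow> (nat \<Rightarrow> 'a) \<Rightarrow> (nat \<Rightarrow> 'a) \<Rightarrow> nat" where
  "hamming n X X' = card {i. i < n \<and> X i \<noteq> X' i}"

definition diff_private ::
  "real \<Rightarrow> nat \<Rightarrow> nat \<Rightarrow> 'b measure \<Rightarrow> ((nat \<Rightarrow> nat \<Rightarrow> real) \<Rightarrow> 'b measure) \<Rightarrow> bool" where
  "diff_private \<epsilon> n d N \<A> \<longleftrightarrow>
     (\<forall>X\<in>space (dataset n d). \<forall>X'\<in>space (dataset n d). \<forall>S\<in>sets N.
        measure (\<A> X) S \<le> exp (\<epsilon> * real (hamming n X X')) * measure (\<A> X') S)"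

definition param_sum ::
  "nat \<Rightarrow> nat \<Rightarrow> real \<Rightarrow> real \<Rightarrow> real \<Rightarrow> real \<Rightarrow> real \<Rightarrow> real \<Rightarrow> real \<Rightarrow> real" where
  "param_sum d M q Rmax Rmin r L \<epsilon> \<alpha> =
     (\<Sum>x\<leftarrow>[real d, real M, q, Rmax, Rmin, r, L, \<epsilon>, \<alpha>]. x + 1 / x)"

text \<open>Polylogarithmic bound for a positive sample size. The \<open>max\<close> with 1 is needed only for
  parameters whose admissible class is empty: there \<open>g\<close> can be arbitrarily small while
  \<open>n \<ge> 1\<close>. If the class is inhabited and \<open>C \<ge> 1\<close>, it has no
  effect, by \<open>admissible_bound_ge_1\<close> below.\<close>

definition soft_O :: "real \<Rightarrow> real \<Rightarrow> nat \<Rightarrow> real \<Rightarrow> bool" where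
  "soft_O C s n g \<longleftrightarrow> real n \<le> max 1 (C * g * ln (2 + s) powr C)"

definition sample_rate :: "nat \<Rightarrow> nat \<Rightarrow> real \<Rightarrow> real \<Rightarrow> real \<Rightarrow> real \<Rightarrow> real \<Rightarrow> real" where
  "sample_rate d M Rmin r L \<epsilon> \<alpha> =
     real d / (\<alpha>\<^sup>2 * L\<^sup>2) + real M / (\<epsilon> * L * \<alpha>) + real M / (\<epsilon> * L * min r Rmin)"

lemma admissible_mass:
  assumes D: "D \<in> admissible P d q Rmax Rmin r L" and d: "d \<ge> 1" and pos: "r > 0" "L > 0"
  shows "L * (2 * r) \<le> 1"
proof -
  define \<theta> where "\<theta> = restrict (\<lambda>i. if i = 0 then 1 else 0 :: real) {..<d}"
  have "(\<Sum>i<d. (\<theta> i)\<^sup>2) = (\<Sum>i\<in>{..<d}. if i = 0 then 1 else 0)"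
    by (rule sum.cong) (auto simp: \<theta>_def)
  also have "\<dots> = 1"
    using d by (simp add: sum.delta)
  finally have "\<theta> \<in> unit_sphere d"
    by (auto simp: unit_sphere_def norm_d_def L2_set_def Rd_def space_PiM \<theta>_def)
  then obtain f :: "real \<Rightarrow> real" where
    f: "distributed D lborel (\<lambda>x. inner_d d x \<theta>) (\<lambda>t. ennreal (f t))" and
    ge: "\<And>t. t \<in> {dir_quantile d q D \<theta> - r .. dir_quantile d q D \<theta> + r} \<Longrightarrow> f t \<ge> L"
    using D unfolding admissible_def by blast
  interpret prob_space D
    using D by (simp add: admissible_def)
  let ?I = "{dir_quantile d q D \<theta> - r .. dir_quantile d q D \<theta> + r}"
  have "ennreal (L * (2 * r)) = (\<integral>\<^sup>+t. ennreal L * indicator ?I t \<partial>lborel)"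
    using pos by (simp add: nn_integral_cmult_indicator ennreal_mult)
  also have "\<dots> \<le> (\<integral>\<^sup>+t. ennreal (f t) * indicator ?I t \<partial>lborel)"
    using ge by (intro nn_integral_mono) (auto simp: indicator_def intro!: ennreal_leI)
  also have "\<dots> = emeasure D ((\<lambda>x. inner_d d x \<theta>) -` ?I \<inter> space D)"
    using distributed_emeasure[OF f, of ?I] by simp
  also have "\<dots> \<le> 1"
    by (rule emeasure_le_1)
  finally show ?thesis
    by simp
qed

lemma admissible_bound_ge_1:
  assumes D: "D \<in> admissible P d q Rmax Rmin r L" and dM: "d \<ge> 1" "M \<ge> 1"
    and pos: "q > 0" "Rmax > 0" "Rmin > 0" "r > 0" "L > 0" "\<epsilon> > 0"
    and \<alpha>: "0 < \<alpha>" "\<alpha> < min r Rmin / 2" and C: "C \<ge> 1"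
  shows "C * sample_rate d M Rmin r L \<epsilon> \<alpha> * ln (2 + param_sum d M q Rmax Rmin r L \<epsilon> \<alpha>) powr C \<ge> 1"
proof -
  have "L * \<alpha> \<le> L * (2 * r)"
    using \<alpha> pos by (intro mult_left_mono) auto
  hence "L * \<alpha> \<le> 1"
    using admissible_mass[OF D dM(1) pos(4,5)] by linarith
  hence "(\<alpha> * L)\<^sup>2 \<le> 1"
    using \<alpha> pos by (simp add: power_le_one mult.commute)
  hence "1 \<le> real d / (\<alpha>\<^sup>2 * L\<^sup>2)"
    using \<alpha> pos dM by (simp add: le_divide_eq power_mult_distrib)
  moreover have "real M / (\<epsilon> * L * \<alpha>) \<ge> 0" "real M / (\<epsilon> * L * min r Rmin) \<ge> 0"
    using \<alpha> pos by simp_all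
  ultimately have g: "sample_rate d M Rmin r L \<epsilon> \<alpha> \<ge> 1"
    unfolding sample_rate_def by linarith
  have "3 \<le> 2 + param_sum d M q Rmax Rmin r L \<epsilon> \<alpha>"
    using dM pos \<alpha> by (simp add: param_sum_def add_nonneg_nonneg add_increasing2)
  hence "exp 1 \<le> 2 + param_sum d M q Rmax Rmin r L \<epsilon> \<alpha>"
    using exp_le by linarith
  hence "1 \<le> ln (2 + param_sum d M q Rmax Rmin r L \<epsilon> \<alpha>)"
    by (subst ln_ge_iff) (auto intro: less_le_trans[OF exp_gt_zero])
  hence "1 \<le> ln (2 + param_sum d M q Rmax Rmin r L \<epsilon> \<alpha>) powr C"
    using C by (simp add: ge_one_powr_ge_zero)
  with g C show ?thesis
    by (metis mult_mono' mult_1 zero_le_one order_trans)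
qed

end

theory Submission
  imports Defs
begin

text \<open>
  All \<open>M\<close> quantiles are released by a single draw of the exponential mechanism, whose candidates are
  the functions from \<open>\<Theta>\<close> to a grid of step \<open>\<alpha>\<close> in \<open>[-Rmax, Rmax]\<close>. The loss of a candidate \<open>v\<close> is the
  maximum over \<open>\<theta> \<in> \<Theta>\<close> of the number of data points that would have to move for \<open>v \<theta>\<close> to come within
  \<open>3\<alpha>/4\<close> of an empirical quantile in direction \<open>\<theta>\<close>. Replacing one data point changes every count, hence
  also this maximum, by at most one (\<open>joint_loss_hamming\<close>). So the privacy cost does not grow with the
  number of directions: in the accuracy of the draw, \<open>M\<close> enters only through the logarithm of the number \<open>K ^ M\<close> of candidates,
  where \<open>K\<close> is the size of the grid.

  The tolerance in the loss is essential. The density of a projection is bounded below near the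
  quantile \<open>Q\<close> but it may be arbitrarily large, so the distribution function may climb steeply across
  \<open>q\<close> between two grid points and no grid point need have empirical rank close to \<open>q\<close>. The lower bound on
  the density does however separate the distribution function from \<open>q\<close> on both sides: at \<open>Q \<plusminus> \<alpha>/4\<close> it
  differs from \<open>q\<close> by at least \<open>L \<alpha> / 4\<close> (\<open>quantile_margin\<close>). By Hoeffding's inequality at these two points
  for each of the \<open>M\<close> directions, the empirical frequencies keep half of this margin as soon as \<open>n\<close> is of
  order \<open>ln M / (\<alpha>\<^sup>2 L\<^sup>2)\<close> (\<open>typical_samples_probability\<close>). On such a sample the candidate that rounds
  every quantile to the grid, with error at most \<open>\<alpha>/2\<close>, has loss 0, and a candidate that is wrong by
  more than \<open>\<alpha>\<close> in some direction has loss at least \<open>n L \<alpha> / 8\<close>. A union bound over the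
  candidates shows that a wrong one is drawn with probability at most \<open>K ^ M * exp (- \<epsilon> n L \<alpha> / 16)\<close>
  (\<open>quantile_mechanism_accurate_on_typical\<close>), which is small once \<open>n\<close> is of order \<open>M ln K / (\<epsilon> L \<alpha>)\<close>.
  As \<open>K\<close> is at most \<open>2 Rmax / \<alpha> + 2\<close>, both requirements are within logarithmic factors of the first two
  terms of the rate (\<open>sample_size\<close>).
\<close>

section \<open>The exponential mechanism on a finite set\<close>

definition exp_mechanism :: "real \<Rightarrow> 'b measure \<Rightarrow> 'b set \<Rightarrow> ('b \<Rightarrow> real) \<Rightarrow> 'b measure" where
  "exp_mechanism \<beta> N V \<phi> =
     distr (point_measure V (\<lambda>v. ennreal (exp (- \<beta> * \<phi> v) / (\<Sum>u\<in>V. exp (- \<beta> * \<phi> u))))) N (\<lambda>v. v)"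

lemma sets_exp_mechanism [simp, measurable_cong]: "sets (exp_mechanism \<beta> N V \<phi>) = sets N"
  by (simp add: exp_mechanism_def)

lemma partition_function_pos:
  assumes "finite V" "V \<noteq> {}"
  shows "(\<Sum>u\<in>V. exp (- \<beta> * \<phi> u :: real)) > 0"
  using assms by (intro sum_pos) auto

lemma emeasure_exp_mechanism:
  assumes V: "finite V" "V \<noteq> {}" "V \<subseteq> space N" and S: "S \<in> sets N"
  shows "emeasure (exp_mechanism \<beta> N V \<phi>) S =
           ennreal ((\<Sum>v\<in>V \<inter> S. exp (- \<beta> * \<phi> v)) / (\<Sum>u\<in>V. exp (- \<beta> * \<phi> u)))"
proof -
  let ?Z = "\<Sum>u\<in>V. exp (- \<beta> * \<phi> u)"
  let ?p = "point_measure V (\<lambda>v. ennreal (exp (- \<beta> * \<phi> v) / ?Z))"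
  have "emeasure (exp_mechanism \<beta> N V \<phi>) S = emeasure ?p ((\<lambda>v. v) -` S \<inter> space ?p)"
    unfolding exp_mechanism_def using V S
    by (intro emeasure_distr) (auto simp: measurable_def space_point_measure sets_point_measure)
  also have "(\<lambda>v. v) -` S \<inter> space ?p = V \<inter> S"
    by (auto simp: space_point_measure)
  also have "emeasure ?p (V \<inter> S) = (\<Sum>v\<in>V \<inter> S. ennreal (exp (- \<beta> * \<phi> v) / ?Z))"
    using V by (intro emeasure_point_measure_finite) auto
  also have "\<dots> = ennreal (\<Sum>v\<in>V \<inter> S. exp (- \<beta> * \<phi> v) / ?Z)"
    using partition_function_pos[OF V(1,2), of \<beta> \<phi>] by (intro sum_ennreal) (auto simp: less_imp_le)
  finally show ?thesis
    by (simp add: sum_divide_distrib)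
qed

lemma measure_exp_mechanism:
  assumes V: "finite V" "V \<noteq> {}" "V \<subseteq> space N" and S: "S \<in> sets N"
  shows "measure (exp_mechanism \<beta> N V \<phi>) S =
           (\<Sum>v\<in>V \<inter> S. exp (- \<beta> * \<phi> v)) / (\<Sum>u\<in>V. exp (- \<beta> * \<phi> u))"
  unfolding measure_def emeasure_exp_mechanism[OF assms]
  by (intro enn2real_ennreal divide_nonneg_nonneg sum_nonneg) auto

lemma prob_space_exp_mechanism:
  assumes V: "finite V" "V \<noteq> {}" "V \<subseteq> space N"
  shows "prob_space (exp_mechanism \<beta> N V \<phi>)"
proof
  have "V \<inter> space N = V"
    using V by auto
  moreover have "space (exp_mechanism \<beta> N V \<phi>) = space N"
    by (simp add: exp_mechanism_def)
  ultimately show "emeasure (exp_mechanism \<beta> N V \<phi>) (space (exp_mechanism \<beta> N V \<phi>)) = 1"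
    using partition_function_pos[OF V(1,2), of \<beta> \<phi>]
    by (simp add: emeasure_exp_mechanism[OF V sets.top])
qed

lemma measurable_exp_mechanism:
  assumes V: "finite V" "V \<noteq> {}" "V \<subseteq> space N"
    and \<phi>: "\<And>v. v \<in> V \<Longrightarrow> (\<lambda>x. \<phi> x v) \<in> borel_measurable M"
  shows "(\<lambda>x. exp_mechanism \<beta> N V (\<phi> x)) \<in> M \<rightarrow>\<^sub>M prob_algebra N"
proof (rule measurable_prob_algebraI)
  show "prob_space (exp_mechanism \<beta> N V (\<phi> x))" for x
    by (rule prob_space_exp_mechanism[OF V])
  show "(\<lambda>x. exp_mechanism \<beta> N V (\<phi> x)) \<in> M \<rightarrow>\<^sub>M subprob_algebra N"
  proof (rule measurable_subprob_algebra)
    show "subprob_space (exp_mechanism \<beta> N V (\<phi> x))" for x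
      by (intro prob_space_imp_subprob_space prob_space_exp_mechanism[OF V])
    have sum: "(\<lambda>x. \<Sum>v\<in>W. exp (- \<beta> * \<phi> x v)) \<in> borel_measurable M" if "W \<subseteq> V" for W
    proof (rule borel_measurable_sum)
      fix v assume "v \<in> W"
      with that have [measurable]: "(\<lambda>x. \<phi> x v) \<in> borel_measurable M"
        by (intro \<phi>) auto
      show "(\<lambda>x. exp (- \<beta> * \<phi> x v)) \<in> borel_measurable M"
        by measurable
    qed
    fix S assume S: "S \<in> sets N"
    show "(\<lambda>x. emeasure (exp_mechanism \<beta> N V (\<phi> x)) S) \<in> borel_measurable M"
      unfolding emeasure_exp_mechanism[OF V S]
      by (rule measurable_compose[OF borel_measurable_divide[OF sum sum] measurable_ennreal]) simp_all
  qed simp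
qed

text \<open>Every weight changes by a factor of at most \<open>exp (\<beta> k)\<close>, and so does the normalizing sum. This
  is where the factor 2 between \<open>\<beta>\<close> and the privacy parameter comes from.\<close>

lemma exp_mechanism_private:
  assumes V: "finite V" "V \<noteq> {}" "V \<subseteq> space N" and S: "S \<in> sets N" and \<beta>: "\<beta> \<ge> 0"
    and close: "\<And>v. v \<in> V \<Longrightarrow> \<bar>\<phi> v - \<phi>' v\<bar> \<le> k"
  shows "measure (exp_mechanism \<beta> N V \<phi>) S \<le> exp (2 * \<beta> * k) * measure (exp_mechanism \<beta> N V \<phi>') S"
proof -
  have w: "exp (- \<beta> * f v) \<le> exp (\<beta> * k) * exp (- \<beta> * g v)" if "\<bar>f v - g v\<bar> \<le> k" for f g :: "'a \<Rightarrow> real" and v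
  proof -
    have "\<beta> * (g v - f v) \<le> \<beta> * k"
      using that \<beta> by (intro mult_left_mono) auto
    then show ?thesis
      by (simp add: algebra_simps flip: exp_add)
  qed
  let ?Z = "\<lambda>\<phi>. \<Sum>u\<in>V. exp (- \<beta> * \<phi> u)" and ?W = "\<lambda>\<phi>. \<Sum>u\<in>V \<inter> S. exp (- \<beta> * \<phi> u)"
  have W: "?W \<phi> \<le> exp (\<beta> * k) * ?W \<phi>'"
    unfolding sum_distrib_left using close by (intro sum_mono w) auto
  have Z: "?Z \<phi>' \<le> exp (\<beta> * k) * ?Z \<phi>"
    unfolding sum_distrib_left using close by (intro sum_mono w) (auto simp: abs_minus_commute)
  note pos = partition_function_pos[OF V(1,2)]
  have "?W \<phi> * ?Z \<phi>' \<le> (exp (\<beta> * k) * ?W \<phi>') * (exp (\<beta> * k) * ?Z \<phi>)"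
    using W Z by (intro mult_mono) (auto intro!: sum_nonneg mult_nonneg_nonneg)
  also have "\<dots> = exp (2 * \<beta> * k) * ?W \<phi>' * ?Z \<phi>"
  proof -
    have "exp (2 * \<beta> * k) = exp (\<beta> * k) * exp (\<beta> * k)"
      by (simp flip: exp_add)
    then show ?thesis
      by (simp only: mult_ac)
  qed
  finally have cross: "?W \<phi> * ?Z \<phi>' \<le> exp (2 * \<beta> * k) * ?W \<phi>' * ?Z \<phi>" .
  have "x / z \<le> e * (x' / z')" if "x * z' \<le> e * x' * z" "z > 0" "z' > 0" for x z x' z' e :: real
    using mult_imp_div_pos_le[OF that(2,1)] mult_imp_le_div_pos[OF that(3), of "x / z" "e * x'"] by simp
  from this[OF cross pos pos] show ?thesis
    unfolding measure_exp_mechanism[OF V S] .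
qed

text \<open>A candidate of nonpositive loss makes the normalizing sum at least 1, so that no bad candidate
  has probability above \<open>exp (- \<beta> b)\<close>.\<close>

lemma exp_mechanism_accurate:
  assumes V: "finite V" "V \<noteq> {}" "V \<subseteq> space N" and S: "S \<in> sets N" and \<beta>: "\<beta> \<ge> 0"
    and opt: "v\<^sub>0 \<in> V" "\<phi> v\<^sub>0 \<le> 0" and bad: "\<And>v. v \<in> V \<Longrightarrow> v \<notin> S \<Longrightarrow> b \<le> \<phi> v"
  shows "measure (exp_mechanism \<beta> N V \<phi>) S \<ge> 1 - real (card V) * exp (- \<beta> * b)"
proof -
  let ?w = "\<lambda>v. exp (- \<beta> * \<phi> v)"
  let ?Z = "sum ?w V"
  have "1 \<le> ?w v\<^sub>0"
    using opt \<beta> by (simp add: mult_nonneg_nonpos)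
  also have "\<dots> \<le> ?Z"
    using V opt by (intro member_le_sum) auto
  finally have Z: "1 \<le> ?Z" .
  have "sum ?w (V - S) \<le> (\<Sum>v\<in>V - S. exp (- \<beta> * b))"
    using bad \<beta> by (intro sum_mono) (auto intro!: mult_left_mono)
  also have "\<dots> \<le> real (card V) * exp (- \<beta> * b)"
    using V by (auto intro!: mult_right_mono card_mono)
  also have "\<dots> \<le> real (card V) * exp (- \<beta> * b) * ?Z"
    using mult_left_mono[OF Z, of "real (card V) * exp (- \<beta> * b)"] by simp
  finally have "sum ?w (V - S) \<le> real (card V) * exp (- \<beta> * b) * ?Z" .
  moreover have "?Z = sum ?w (V \<inter> S) + sum ?w (V - S)"
    using V by (intro sum.Int_Diff)
  ultimately show ?thesis
    unfolding measure_exp_mechanism[OF V S] using Z by (simp add: field_simps)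
qed

text \<open>Conditioning on a good event for the data: this separates the randomness of the sample from the
  randomness of the mechanism.\<close>

lemma measure_bind_ge_mult:
  assumes M: "M \<in> space (prob_algebra N)" and K: "K \<in> N \<rightarrow>\<^sub>M prob_algebra R"
    and E: "E \<in> sets M" and S: "S \<in> sets R"
    and b: "\<And>x. x \<in> E \<Longrightarrow> b \<le> measure (K x) S" "0 \<le> b"
  shows "measure (M \<bind> K) S \<ge> measure M E * b"
proof -
  interpret M: prob_space M
    using M by (simp add: space_prob_algebra)
  interpret MK: prob_space "M \<bind> K"
    by (rule prob_space_bind'[OF M K])
  have "ennreal (measure M E * b) = (\<integral>\<^sup>+x. ennreal b * indicator E x \<partial>M)"
    using E b(2) by (simp add: nn_integral_cmult_indicator M.emeasure_eq_measure ennreal_mult mult.commute)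
  also have "\<dots> \<le> (\<integral>\<^sup>+x. emeasure (K x) S \<partial>M)"
  proof (intro nn_integral_mono)
    fix x assume x: "x \<in> space M"
    have "space M = space N"
      by (rule sets_eq_imp_space_eq) (use M in \<open>simp add: space_prob_algebra\<close>)
    then interpret prob_space "K x"
      using measurable_space[OF K] x by (auto simp: space_prob_algebra)
    show "ennreal b * indicator E x \<le> emeasure (K x) S"
      using b(1) by (auto simp: indicator_def emeasure_eq_measure intro: ennreal_leI)
  qed
  also have "\<dots> = emeasure (M \<bind> K) S"
    by (rule emeasure_bind_prob_algebra[OF M K S, symmetric])
  also have "\<dots> = ennreal (measure (M \<bind> K) S)"
    by (rule MK.emeasure_eq_measure)
  finally show ?thesis
    by simp
qed

section \<open>Concentration of empirical frequencies\<close>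

text \<open>Hoeffding's inequality for the coordinates of the product space, which are independent with
  law \<open>D\<close>.\<close>

lemma
  assumes D: "prob_space D" and B [measurable]: "B \<in> sets D" and n: "n > 0" and \<eta>: "\<eta> \<ge> 0"
  shows frequency_upper_tail: "measure (PiM {..<n} (\<lambda>_. D))
        {X \<in> space (PiM {..<n} (\<lambda>_. D)). (\<Sum>i<n. indicator B (X i)) \<ge> real n * measure D B + real n * \<eta>}
        \<le> exp (- 2 * real n * \<eta>\<^sup>2)" (is ?U)
    and frequency_lower_tail: "measure (PiM {..<n} (\<lambda>_. D))
        {X \<in> space (PiM {..<n} (\<lambda>_. D)). (\<Sum>i<n. indicator B (X i)) \<le> real n * measure D B - real n * \<eta>}
        \<le> exp (- 2 * real n * \<eta>\<^sup>2)" (is ?L)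
proof -
  let ?M = "PiM {..<n} (\<lambda>_. D)"
  interpret D: prob_space D by (rule D)
  interpret M: prob_space ?M by (rule prob_space_PiM) (rule D)
  have distr: "distr ?M D (\<lambda>X. X i) = D" if "i < n" for i
    using that by (intro distr_PiM_component D) auto
  have "M.indep_vars (\<lambda>_. D) (\<lambda>i X. X i) {..<n}"
  proof (subst M.indep_vars_iff_distr_eq_PiM')
    have "distr ?M ?M (\<lambda>X. \<lambda>i\<in>{..<n}. X i) = distr ?M ?M (\<lambda>X. X)"
      by (intro distr_cong) (auto simp: space_PiM PiE_def extensional_restrict)
    also have "\<dots> = PiM {..<n} (\<lambda>i. distr ?M D (\<lambda>X. X i))"
      by (subst distr_id2) (auto intro!: PiM_cong simp: distr)
    finally show "distr ?M ?M (\<lambda>X. \<lambda>i\<in>{..<n}. X i) = PiM {..<n} (\<lambda>i. distr ?M D (\<lambda>X. X i))" .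
  qed (use n in auto)
  then have indep: "M.indep_vars (\<lambda>_. borel) (\<lambda>i X. indicator B (X i) :: real) {..<n}"
    by (rule M.indep_vars_compose2) measurable
  have expect: "M.expectation (\<lambda>X. indicator B (X i)) = measure D B" if "i < n" for i
  proof -
    have "M.expectation (\<lambda>X. indicator B (X i) :: real) = integral\<^sup>L (distr ?M D (\<lambda>X. X i)) (indicator B)"
      using that by (subst integral_distr) auto
    then show ?thesis
      using that by (simp add: distr)
  qed
  interpret H: Hoeffding_ineq ?M "{..<n}" "\<lambda>i X. indicator B (X i) :: real" "\<lambda>_. 0" "\<lambda>_. 1"
      "\<Sum>i<n. M.expectation (\<lambda>X. indicator B (X i))"
  proof unfold_locales
    show "M.indep_vars (\<lambda>_. borel) (\<lambda>i X. indicator B (X i) :: real) {..<n}"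
      by (rule indep)
    show "AE X in ?M. (indicator B (X i) :: real) \<in> {0..1}" for i
      by (simp add: indicator_def)
  qed simp_all
  have eq: "- 2 * (real n * \<eta>)\<^sup>2 / (\<Sum>i<n. (1 - 0)\<^sup>2) = - 2 * real n * \<eta>\<^sup>2"
    using n by (simp add: power2_eq_square)
  have ge0: "real n * \<eta> \<ge> 0" and pos: "(\<Sum>i<n. (1 - 0 :: real)\<^sup>2) > 0"
    using n \<eta> by auto
  show ?U
    using H.Hoeffding_ineq_ge[OF ge0 pos] unfolding eq by (simp add: expect)
  show ?L
    using H.Hoeffding_ineq_le[OF ge0 pos] unfolding eq by (simp add: expect)
qed

section \<open>Quantiles of laws with a density bounded below\<close>

text \<open>By the definition of the quantile \<open>Q\<close> as an infimum, the distribution function is at least \<open>q\<close>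
  strictly to the right of \<open>Q\<close> and below \<open>q\<close> strictly to the left of it. The mass between
  \<open>Q + s\<close> and \<open>Q + \<delta>\<close> is at least \<open>L (\<delta> - s)\<close>, and \<open>s\<close> tends to 0; similarly on the left.\<close>

lemma quantile_margin:
  assumes D: "prob_space D" and q: "0 < q" "q < 1"
    and f: "distributed D lborel Y (\<lambda>t. ennreal (f t))"
    and L: "L \<ge> 0" "\<And>t. t \<in> {quantile D q Y - r .. quantile D q Y + r} \<Longrightarrow> L \<le> f t"
    and \<delta>: "0 < \<delta>" "\<delta> \<le> r"
  shows "measure D {x \<in> space D. Y x \<le> quantile D q Y + \<delta>} \<ge> q + L * \<delta>" (is ?upper)
    and "measure D {x \<in> space D. Y x \<le> quantile D q Y - \<delta>} \<le> q - L * \<delta>" (is ?lower)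
proof -
  interpret D: prob_space D by (rule D)
  have Y [measurable]: "Y \<in> borel_measurable D"
    using distributed_measurable[OF f] by simp
  interpret Y: real_distribution "distr D borel Y"
    by (simp add: D.real_distribution_distr)
  define F where "F t = measure D {x \<in> space D. Y x \<le> t}" for t
  define Q where "Q = quantile D q Y"
  have cdf: "cdf (distr D borel Y) = F"
    by (auto simp: cdf_def F_def measure_distr fun_eq_iff intro!: arg_cong[where f = "measure D"])
  have mono: "F s \<le> F t" if "s \<le> t" for s t
    using Y.cdf_nondecreasing[OF that] by (simp add: cdf)
  have Q: "Q = Inf {t. q \<le> F t}"
    by (simp add: Q_def quantile_def F_def)
  obtain t\<^sub>1 where t\<^sub>1: "q \<le> F t\<^sub>1"
  proof -
    have "eventually (\<lambda>t. F t > q) at_top"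
      using Y.cdf_lim_at_top_prob q unfolding cdf by (auto elim: order_tendstoD)
    then show ?thesis
      using that by (auto simp: eventually_at_top_linorder intro: less_imp_le)
  qed
  obtain t\<^sub>0 where t\<^sub>0: "F t\<^sub>0 < q"
  proof -
    have "eventually (\<lambda>t. F t < q) at_bot"
      using Y.cdf_lim_at_bot q unfolding cdf by (auto elim: order_tendstoD)
    then show ?thesis
      using that by (auto simp: eventually_at_bot_linorder)
  qed
  have bdd: "bdd_below {t. q \<le> F t}"
  proof (rule bdd_belowI)
    fix t assume "t \<in> {t. q \<le> F t}"
    then show "t\<^sub>0 \<le> t"
      using t\<^sub>0 mono[of t t\<^sub>0] by (cases "t \<le> t\<^sub>0") auto
  qed
  have below: "F t \<le> q" if "t < Q" for t
    using cInf_lower[OF _ bdd, of t] that by (fastforce simp: Q)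
  have above: "q \<le> F t" if t: "Q < t" for t
  proof -
    obtain s where "q \<le> F s" "s < t"
      using cInf_lessD[of "{t. q \<le> F t}" t] t t\<^sub>1 by (auto simp: Q)
    then show ?thesis
      using mono[of s t] by linarith
  qed
  have mass: "L * (b - a) \<le> F b - F a" if ab: "Q - r \<le> a" "a \<le> b" "b \<le> Q + r" for a b
  proof -
    have "ennreal (L * (b - a)) = (\<integral>\<^sup>+t. ennreal L * indicator {a<..b} t \<partial>lborel)"
      using ab L by (simp add: nn_integral_cmult_indicator ennreal_mult)
    also have "\<dots> \<le> (\<integral>\<^sup>+t. ennreal (f t) * indicator {a<..b} t \<partial>lborel)"
      using L(2) ab unfolding Q_def
      by (intro nn_integral_mono) (auto simp: indicator_def intro!: ennreal_leI)
    also have "\<dots> = emeasure D (Y -` {a<..b} \<inter> space D)"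
      using distributed_emeasure[OF f, of "{a<..b}"] by simp
    also have "Y -` {a<..b} \<inter> space D = {x \<in> space D. Y x \<le> b} - {x \<in> space D. Y x \<le> a}"
      by auto
    also have "emeasure D \<dots> = ennreal (F b - F a)"
      unfolding D.emeasure_eq_measure F_def using ab
      by (subst D.finite_measure_Diff) auto
    finally show ?thesis
      using mono[OF ab(2)] by (simp add: ennreal_le_iff)
  qed
  have lim: "((\<lambda>s. L * (\<delta> - s)) \<longlongrightarrow> L * (\<delta> - 0)) (at_right 0)"
    by (intro tendsto_intros)
  have near: "eventually (\<lambda>s::real. s \<in> {0<..<\<delta>}) (at_right 0)"
    using \<delta> by (intro eventually_at_right_real) auto
  have "L * (\<delta> - 0) \<le> F (Q + \<delta>) - q"
  proof (rule tendsto_upperbound[OF lim])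
    show "eventually (\<lambda>s. L * (\<delta> - s) \<le> F (Q + \<delta>) - q) (at_right 0)"
      using near
    proof eventually_elim
      case (elim s)
      then show ?case
        using mass[of "Q + s" "Q + \<delta>"] above[of "Q + s"] \<delta> by auto
    qed
  qed simp
  then show ?upper
    by (simp add: F_def Q_def)
  have "L * (\<delta> - 0) \<le> q - F (Q - \<delta>)"
  proof (rule tendsto_upperbound[OF lim])
    show "eventually (\<lambda>s. L * (\<delta> - s) \<le> q - F (Q - \<delta>)) (at_right 0)"
      using near
    proof eventually_elim
      case (elim s)
      then show ?case
        using mass[of "Q - \<delta>" "Q - s"] below[of "Q - s"] \<delta> by auto
    qed
  qed simp
  then show ?lower
    by (simp add: F_def Q_def)
qed

section \<open>The loss of a candidate quantile\<close>

text \<open>Here \<open>c t\<close> counts the data points in \<open>(-\<infinity>, t]\<close> and \<open>m\<close> is the target rank. The number \<open>t\<close> is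
  within \<open>w\<close> of a point of rank \<open>m\<close> when \<open>c (t - w) \<le> m \<le> c (t + w)\<close>, and the loss is the number of
  points by which this fails.\<close>

definition quantile_loss :: "real \<Rightarrow> real \<Rightarrow> (real \<Rightarrow> real) \<Rightarrow> real \<Rightarrow> real" where
  "quantile_loss w m c t = max 0 (max (c (t - w) - m) (m - c (t + w)))"

lemma quantile_loss_lipschitz:
  assumes "\<And>t. \<bar>c t - c' t\<bar> \<le> k"
  shows "\<bar>quantile_loss w m c t - quantile_loss w m c' t\<bar> \<le> k"
  using assms[of "t - w"] assms[of "t + w"] unfolding quantile_loss_def by linarith

text \<open>\<open>Q\<close> is the true quantile and \<open>\<delta>\<close> the distance at which the counts are known to be on the
  correct side of the target rank. The window around \<open>t\<close> then covers \<open>[Q - \<delta>, Q + \<delta>]\<close>.\<close>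

lemma quantile_loss_eq_0:
  assumes c: "mono c" and "c (Q - \<delta>) \<le> m" "m \<le> c (Q + \<delta>)" and t: "\<bar>t - Q\<bar> \<le> w - \<delta>"
  shows "quantile_loss w m c t = 0"
proof -
  have "t - w \<le> Q - \<delta>" "Q + \<delta> \<le> t + w"
    using t by linarith+
  note this[THEN monoD[OF c]]
  then show ?thesis
    using assms unfolding quantile_loss_def by linarith
qed

text \<open>The window around \<open>t\<close> now lies entirely on one side of \<open>[Q - \<delta>, Q + \<delta>]\<close>, where the counts miss
  the target rank by \<open>k\<close>.\<close>

lemma quantile_loss_ge:
  assumes c: "mono c" and "c (Q - \<delta>) \<le> m - k" "m + k \<le> c (Q + \<delta>)" and t: "\<bar>t - Q\<bar> \<ge> w + \<delta>"
  shows "quantile_loss w m c t \<ge> k"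
proof (cases "t \<ge> Q")
  case True
  then have "Q + \<delta> \<le> t - w"
    using t by linarith
  note monoD[OF c this]
  then show ?thesis
    using assms unfolding quantile_loss_def by linarith
next
  case False
  then have "t + w \<le> Q - \<delta>"
    using t by linarith
  note monoD[OF c this]
  then show ?thesis
    using assms unfolding quantile_loss_def by linarith
qed

definition sample_count :: "nat \<Rightarrow> nat \<Rightarrow> (nat \<Rightarrow> nat \<Rightarrow> real) \<Rightarrow> (nat \<Rightarrow> real) \<Rightarrow> real \<Rightarrow> real" where
  "sample_count n d X \<theta> t = (\<Sum>i<n. indicator {x. inner_d d x \<theta> \<le> t} (X i))"

lemma mono_sample_count: "mono (sample_count n d X \<theta>)"
  unfolding sample_count_def by (intro monoI sum_mono) (auto simp: indicator_def)

lemma sample_count_hamming: "\<bar>sample_count n d X \<theta> t - sample_count n d X' \<theta> t\<bar> \<le> real (hamming n X X')"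
proof -
  let ?I = "\<lambda>X i. indicator {x. inner_d d x \<theta> \<le> t} (X i) :: real"
  have "\<bar>sample_count n d X \<theta> t - sample_count n d X' \<theta> t\<bar> \<le> (\<Sum>i<n. \<bar>?I X i - ?I X' i\<bar>)"
    by (simp add: sample_count_def sum_abs flip: sum_subtractf)
  also have "\<dots> \<le> (\<Sum>i<n. if X i \<noteq> X' i then 1 else 0)"
    by (intro sum_mono) (auto simp: indicator_def)
  also have "\<dots> = real (hamming n X X')"
    by (simp add: hamming_def sum.If_cases Int_def)
  finally show ?thesis .
qed

lemma measurable_inner_d [measurable]: "(\<lambda>x. inner_d d x \<theta>) \<in> borel_measurable (Rd d)"
  unfolding inner_d_def Rd_def by measurable

lemma measurable_sample_count [measurable]: "(\<lambda>X. sample_count n d X \<theta> t) \<in> borel_measurable (dataset n d)"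
proof -
  have "(\<lambda>X. indicator {..t} (inner_d d (X i) \<theta>) :: real) \<in> borel_measurable (dataset n d)" if "i < n" for i
  proof -
    have [measurable]: "(\<lambda>X. X i) \<in> dataset n d \<rightarrow>\<^sub>M Rd d"
      unfolding dataset_def using that by (intro measurable_component_singleton) auto
    show ?thesis
      by measurable
  qed
  moreover have "sample_count n d X \<theta> t = (\<Sum>i<n. indicator {..t} (inner_d d (X i) \<theta>))" for X
    by (simp add: sample_count_def indicator_def)
  ultimately show ?thesis
    by simp
qed

text \<open>The maximum over the directions, unlike their sum, keeps the sensitivity of a single
  direction.\<close>

definition joint_loss ::
  "nat \<Rightarrow> nat \<Rightarrow> real \<Rightarrow> real \<Rightarrow> (nat \<Rightarrow> real) set \<Rightarrow> (nat \<Rightarrow> nat \<Rightarrow> real) \<Rightarrow> ((nat \<Rightarrow> real) \<Rightarrow> real) \<Rightarrow> real" where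
  "joint_loss n d q w \<Theta> X v = (MAX \<theta>\<in>\<Theta>. quantile_loss w (real n * q) (sample_count n d X \<theta>) (v \<theta>))"

lemma measurable_joint_loss:
  assumes "finite \<Theta>"
  shows "(\<lambda>X. joint_loss n d q w \<Theta> X v) \<in> borel_measurable (dataset n d)"
  unfolding joint_loss_def quantile_loss_def using assms by measurable

lemma Max_image_lipschitz:
  fixes f g :: "'a \<Rightarrow> real"
  assumes "finite A" "A \<noteq> {}" "\<And>x. x \<in> A \<Longrightarrow> \<bar>f x - g x\<bar> \<le> k"
  shows "\<bar>Max (f ` A) - Max (g ` A)\<bar> \<le> k"
proof -
  have "Max (h ` A) \<le> Max (h' ` A) + k"
    if close: "\<And>x. x \<in> A \<Longrightarrow> \<bar>h x - h' x\<bar> \<le> k" for h h' :: "'a \<Rightarrow> real"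
  proof -
    have "h x \<le> Max (h' ` A) + k" if x: "x \<in> A" for x
    proof -
      have "h' x \<le> Max (h' ` A)"
        using x assms(1) by (intro Max_ge) auto
      then show ?thesis
        using close[OF x] by linarith
    qed
    then show ?thesis
      using assms by (subst Max_le_iff) auto
  qed
  from this[of f g] this[of g f] assms(3) show ?thesis
    by (force simp: abs_minus_commute)
qed

lemma joint_loss_hamming:
  assumes "finite \<Theta>" "\<Theta> \<noteq> {}"
  shows "\<bar>joint_loss n d q w \<Theta> X v - joint_loss n d q w \<Theta> X' v\<bar> \<le> real (hamming n X X')"
  unfolding joint_loss_def
  by (intro Max_image_lipschitz quantile_loss_lipschitz sample_count_hamming assms)

section \<open>The grid\<close>

definition grid :: "real \<Rightarrow> real \<Rightarrow> real set" where
  "grid R \<alpha> = (\<lambda>j. - R + real j * \<alpha>) ` {..nat \<lceil>2 * R / \<alpha>\<rceil>}"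

lemma finite_grid: "finite (grid R \<alpha>)" and grid_nonempty: "grid R \<alpha> \<noteq> {}"
  by (auto simp: grid_def)

lemma card_grid_le:
  assumes "R > 0" "\<alpha> > 0"
  shows "real (card (grid R \<alpha>)) \<le> 2 * R / \<alpha> + 2"
proof -
  have "card (grid R \<alpha>) \<le> Suc (nat \<lceil>2 * R / \<alpha>\<rceil>)"
    unfolding grid_def using card_image_le[of "{..nat \<lceil>2 * R / \<alpha>\<rceil>}"] by simp
  moreover have "2 * R / \<alpha> > 0"
    using assms by simp
  ultimately show ?thesis
    by linarith
qed

lemma grid_near:
  assumes \<alpha>: "\<alpha> > 0" and Q: "Q \<in> {-R..R}"
  shows "\<exists>t\<in>grid R \<alpha>. \<bar>t - Q\<bar> \<le> \<alpha> / 2"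
proof -
  define x where "x = (Q + R) / \<alpha>"
  have x: "0 \<le> x" "x \<le> 2 * R / \<alpha>"
    using assms by (auto simp: x_def intro!: divide_right_mono)
  define j where "j = nat (round x)"
  have "round x \<le> round (2 * R / \<alpha>)"
    by (rule round_mono[OF x(2)])
  also have "\<dots> \<le> \<lceil>2 * R / \<alpha>\<rceil>"
    by (rule ceiling_ge_round)
  finally have j: "j \<le> nat \<lceil>2 * R / \<alpha>\<rceil>"
    by (simp add: j_def)
  have "0 \<le> round x"
    using round_mono[OF x(1)] by simp
  then have "\<bar>real j - x\<bar> \<le> 1 / 2"
    using of_int_round_abs_le[of x] by (simp add: j_def)
  then have "\<bar>real j - x\<bar> * \<alpha> \<le> 1 / 2 * \<alpha>"
    using \<alpha> by (intro mult_right_mono) auto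
  moreover have "\<bar>real j - x\<bar> * \<alpha> = \<bar>(- R + real j * \<alpha>) - Q\<bar>"
  proof -
    have "\<bar>real j - x\<bar> * \<alpha> = \<bar>(real j - x) * \<alpha>\<bar>"
      using \<alpha> by (simp add: abs_mult)
    also have "(real j - x) * \<alpha> = (- R + real j * \<alpha>) - Q"
      using \<alpha> by (simp add: x_def left_diff_distrib)
    finally show ?thesis .
  qed
  ultimately show ?thesis
    using j by (intro bexI[of _ "- R + real j * \<alpha>"]) (auto simp: grid_def)
qed

section \<open>Accuracy of the mechanism\<close>

text \<open>The samples whose empirical frequencies lie on the correct side of \<open>q\<close>, with margin \<open>\<eta>\<close>, at
  distance \<open>\<delta>\<close> from every quantile of interest.\<close>

definition typical_samples ::
  "nat \<Rightarrow> nat \<Rightarrow> real \<Rightarrow> real \<Rightarrow> real \<Rightarrow> (nat \<Rightarrow> real) set \<Rightarrow> (nat \<Rightarrow> real) measure \<Rightarrow> (nat \<Rightarrow> nat \<Rightarrow> real) set" where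
  "typical_samples n d q \<delta> \<eta> \<Theta> D = {X \<in> space (PiM {..<n} (\<lambda>_. D)). \<forall>\<theta>\<in>\<Theta>.
     sample_count n d X \<theta> (dir_quantile d q D \<theta> - \<delta>) \<le> real n * q - real n * \<eta> \<and>
     real n * q + real n * \<eta> \<le> sample_count n d X \<theta> (dir_quantile d q D \<theta> + \<delta>)}"

lemma sets_typical_samples:
  assumes D: "sets D = sets (Rd d)" and "finite \<Theta>"
  shows "typical_samples n d q \<delta> \<eta> \<Theta> D \<in> sets (PiM {..<n} (\<lambda>_. D))"
proof -
  have sets [measurable_cong]: "sets (PiM {..<n} (\<lambda>_. D)) = sets (dataset n d)"
    unfolding dataset_def by (intro sets_PiM_cong) (auto simp: D)
  show ?thesis
    unfolding typical_samples_def using assms(2) by measurable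
qed

text \<open>The margin of \<open>quantile_margin\<close> is \<open>L \<delta>\<close>. Half of it is given up to sampling error, which makes
  each of the \<open>2 card \<Theta>\<close> exceptional events exponentially unlikely.\<close>

lemma typical_samples_probability:
  assumes D: "D \<in> admissible P d q Rmax Rmin r L" and q: "0 < q" "q < 1" and L: "L > 0"
    and \<delta>: "0 < \<delta>" "\<delta> \<le> r" and n: "n > 0" and \<Theta>: "finite \<Theta>" "\<Theta> \<subseteq> unit_sphere d"
  shows "measure (PiM {..<n} (\<lambda>_. D)) (typical_samples n d q \<delta> (L * \<delta> / 2) \<Theta> D)
           \<ge> 1 - 2 * real (card \<Theta>) * exp (- real n * (L * \<delta>)\<^sup>2 / 2)"
proof -
  let ?M = "PiM {..<n} (\<lambda>_. D)" and ?\<eta> = "L * \<delta> / 2" and ?e = "exp (- real n * (L * \<delta>)\<^sup>2 / 2)"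
  let ?Q = "dir_quantile d q D"
  have prob: "prob_space D" and sets [measurable_cong]: "sets D = sets (Rd d)"
    using D by (auto simp: admissible_def)
  interpret M: prob_space ?M
    by (rule prob_space_PiM) (rule prob)
  define B where "B \<theta> t = {x \<in> space D. inner_d d x \<theta> \<le> t}" for \<theta> t
  have B: "B \<theta> t \<in> sets D" for \<theta> t
    unfolding B_def by measurable
  define low where "low \<theta> = {X \<in> space ?M. (\<Sum>i<n. indicator (B \<theta> (?Q \<theta> + \<delta>)) (X i))
                      \<le> real n * measure D (B \<theta> (?Q \<theta> + \<delta>)) - real n * ?\<eta>}" for \<theta>
  define high where "high \<theta> = {X \<in> space ?M. (\<Sum>i<n. indicator (B \<theta> (?Q \<theta> - \<delta>)) (X i))
                      \<ge> real n * measure D (B \<theta> (?Q \<theta> - \<delta>)) + real n * ?\<eta>}" for \<theta>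
  have count: "sample_count n d X \<theta> t = (\<Sum>i<n. indicator (B \<theta> t) (X i))" if "X \<in> space ?M" for X \<theta> t
    unfolding sample_count_def using that
    by (intro sum.cong) (auto simp: B_def indicator_def space_PiM PiE_iff)
  have [measurable]: "B \<theta> t \<in> sets D" for \<theta> t
    by (rule B)
  have sets_tails: "low \<theta> \<in> sets ?M" "high \<theta> \<in> sets ?M" for \<theta>
    unfolding low_def high_def by measurable
  have rate: "- 2 * real n * ?\<eta>\<^sup>2 = - real n * (L * \<delta>)\<^sup>2 / 2"
    by (simp add: power_divide)
  have tails: "measure ?M (low \<theta>) \<le> ?e" "measure ?M (high \<theta>) \<le> ?e" for \<theta>
    using frequency_lower_tail[OF prob B[of \<theta> "?Q \<theta> + \<delta>"] n, of ?\<eta>]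
      frequency_upper_tail[OF prob B[of \<theta> "?Q \<theta> - \<delta>"] n, of ?\<eta>] L \<delta>
    unfolding low_def high_def rate by auto
  (* low and high are deviations from the true frequencies, which are at least 2 \<eta> away from q *)
  have atypical: "space ?M - typical_samples n d q \<delta> ?\<eta> \<Theta> D \<subseteq> (\<Union>\<theta>\<in>\<Theta>. low \<theta> \<union> high \<theta>)"
  proof
    fix X assume "X \<in> space ?M - typical_samples n d q \<delta> ?\<eta> \<Theta> D"
    then obtain \<theta> where X: "X \<in> space ?M" and \<theta>: "\<theta> \<in> \<Theta>"
      and dev: "real n * q - real n * ?\<eta> < sample_count n d X \<theta> (?Q \<theta> - \<delta>) \<or>
          sample_count n d X \<theta> (?Q \<theta> + \<delta>) < real n * q + real n * ?\<eta>"
      by (auto simp: typical_samples_def not_le)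
    obtain f where "distributed D lborel (\<lambda>x. inner_d d x \<theta>) (\<lambda>t. ennreal (f t))"
      and "\<And>t. t \<in> {?Q \<theta> - r .. ?Q \<theta> + r} \<Longrightarrow> L \<le> f t"
      using D \<theta> \<Theta> unfolding admissible_def by blast
    then have "q + L * \<delta> \<le> measure D (B \<theta> (?Q \<theta> + \<delta>))" "measure D (B \<theta> (?Q \<theta> - \<delta>)) \<le> q - L * \<delta>"
      using quantile_margin[OF prob q, of "\<lambda>x. inner_d d x \<theta>" f L r \<delta>] L \<delta>
      by (auto simp: dir_quantile_def B_def)
    then have "real n * (q + L * \<delta>) \<le> real n * measure D (B \<theta> (?Q \<theta> + \<delta>))"
      "real n * measure D (B \<theta> (?Q \<theta> - \<delta>)) \<le> real n * (q - L * \<delta>)"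
      by (auto intro!: mult_left_mono)
    then have "X \<in> low \<theta> \<union> high \<theta>"
      using dev X unfolding low_def high_def count[OF X] by (auto simp: algebra_simps)
    then show "X \<in> (\<Union>\<theta>\<in>\<Theta>. low \<theta> \<union> high \<theta>)"
      using \<theta> by blast
  qed
  have "measure ?M (space ?M - typical_samples n d q \<delta> ?\<eta> \<Theta> D) \<le> measure ?M (\<Union>\<theta>\<in>\<Theta>. low \<theta> \<union> high \<theta>)"
    using \<Theta> sets_tails by (intro M.finite_measure_mono atypical) auto
  also have "\<dots> \<le> (\<Sum>\<theta>\<in>\<Theta>. measure ?M (low \<theta> \<union> high \<theta>))"
    using \<Theta> sets_tails by (intro M.finite_measure_subadditive_finite) auto
  also have "\<dots> \<le> (\<Sum>\<theta>\<in>\<Theta>. ?e + ?e)"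
    using sets_tails tails by (intro sum_mono order_trans[OF measure_Un_le] add_mono) auto
  also have "\<dots> = 2 * real (card \<Theta>) * ?e"
    by simp
  finally show ?thesis
    using M.prob_compl[OF sets_typical_samples[OF sets \<Theta>(1), of n q \<delta> ?\<eta>]] by simp
qed

definition candidates :: "real \<Rightarrow> real \<Rightarrow> (nat \<Rightarrow> real) set \<Rightarrow> ((nat \<Rightarrow> real) \<Rightarrow> real) set" where
  "candidates R \<alpha> \<Theta> = (\<Theta> \<rightarrow>\<^sub>E grid R \<alpha>)"

text \<open>The tolerance \<open>3\<alpha>/4\<close> is the sum of the rounding error \<open>\<alpha>/2\<close> of the grid and the distance
  \<open>\<alpha>/4\<close> at which the frequencies are controlled. Together with another \<open>\<alpha>/4\<close> it gives the final
  error \<open>\<alpha>\<close>.\<close>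

definition quantile_mechanism ::
  "real \<Rightarrow> nat \<Rightarrow> nat \<Rightarrow> real \<Rightarrow> real \<Rightarrow> real \<Rightarrow> (nat \<Rightarrow> real) set \<Rightarrow>
     (nat \<Rightarrow> nat \<Rightarrow> real) \<Rightarrow> ((nat \<Rightarrow> real) \<Rightarrow> real) measure" where
  "quantile_mechanism \<epsilon> n d q R \<alpha> \<Theta> X =
     exp_mechanism (\<epsilon> / 2) (PiM \<Theta> (\<lambda>_. borel)) (candidates R \<alpha> \<Theta>) (joint_loss n d q (3 * \<alpha> / 4) \<Theta> X)"

lemma candidates:
  assumes "finite \<Theta>"
  shows "finite (candidates R \<alpha> \<Theta>)" "candidates R \<alpha> \<Theta> \<noteq> {}"
    "candidates R \<alpha> \<Theta> \<subseteq> space (PiM \<Theta> (\<lambda>_. borel))"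
    "card (candidates R \<alpha> \<Theta>) = card (grid R \<alpha>) ^ card \<Theta>"
  using assms by (auto simp: candidates_def space_PiM PiE_eq_empty_iff grid_nonempty card_PiE
      intro!: finite_PiE finite_grid)

lemma quantile_mechanism_algorithm:
  assumes "finite \<Theta>"
  shows "rand_algorithm n d (PiM \<Theta> (\<lambda>_. borel)) (quantile_mechanism \<epsilon> n d q R \<alpha> \<Theta>)"
  unfolding rand_algorithm_def quantile_mechanism_def
  by (intro measurable_exp_mechanism measurable_joint_loss candidates assms)

lemma quantile_mechanism_private:
  assumes "finite \<Theta>" "\<Theta> \<noteq> {}" and \<epsilon>: "\<epsilon> \<ge> 0"
  shows "diff_private \<epsilon> n d (PiM \<Theta> (\<lambda>_. borel)) (quantile_mechanism \<epsilon> n d q R \<alpha> \<Theta>)"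
  unfolding diff_private_def
proof (intro ballI)
  fix X X' S assume S: "S \<in> sets (PiM \<Theta> (\<lambda>_. borel :: real measure))"
  have "measure (quantile_mechanism \<epsilon> n d q R \<alpha> \<Theta> X) S
      \<le> exp (2 * (\<epsilon> / 2) * real (hamming n X X')) * measure (quantile_mechanism \<epsilon> n d q R \<alpha> \<Theta> X') S"
    unfolding quantile_mechanism_def using \<epsilon>
    by (intro exp_mechanism_private S joint_loss_hamming candidates assms) auto
  then show "measure (quantile_mechanism \<epsilon> n d q R \<alpha> \<Theta> X) S
      \<le> exp (\<epsilon> * real (hamming n X X')) * measure (quantile_mechanism \<epsilon> n d q R \<alpha> \<Theta> X') S"
    by simp
qed

lemma linf_norm_le_iff:
  assumes "finite I" "I \<noteq> {}"
  shows "linf_norm I v \<le> a \<longleftrightarrow> (\<forall>i\<in>I. \<bar>v i\<bar> \<le> a)"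
  unfolding linf_norm_def using assms by (subst Max_le_iff) auto

lemma sets_linf_ball:
  assumes "finite I"
  shows "{v \<in> space (PiM I (\<lambda>_. borel)). linf_norm I (\<lambda>i. v i - u i) \<le> a} \<in> sets (PiM I (\<lambda>_. borel))"
proof -
  have m: "(\<lambda>v. \<bar>v i - u i\<bar>) \<in> borel_measurable (PiM I (\<lambda>_. borel))" if "i \<in> I" for i
    using that by measurable
  have "(\<lambda>v. linf_norm I (\<lambda>i. v i - u i)) \<in> borel_measurable (PiM I (\<lambda>_. borel))"
    unfolding linf_norm_def by (intro borel_measurable_Max[OF assms] m)
  then show ?thesis
    by (rule borel_measurable_le) simp
qed
text \<open>On a typical sample the true quantiles rounded to the grid have loss 0, while every
  unacceptable candidate has loss at least \<open>n \<eta>\<close>.\<close>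

lemma quantile_mechanism_accurate_on_typical:
  assumes \<Theta>: "finite \<Theta>" "\<Theta> \<noteq> {}" and \<epsilon>: "\<epsilon> \<ge> 0" and \<alpha>: "\<alpha> > 0" and \<eta>: "\<eta> \<ge> 0"
    and Q: "\<And>\<theta>. \<theta> \<in> \<Theta> \<Longrightarrow> dir_quantile d q D \<theta> \<in> {-R..R}"
    and X: "X \<in> typical_samples n d q (\<alpha> / 4) \<eta> \<Theta> D"
  shows "measure (quantile_mechanism \<epsilon> n d q R \<alpha> \<Theta> X)
           {v \<in> space (PiM \<Theta> (\<lambda>_. borel)). linf_norm \<Theta> (\<lambda>\<theta>. v \<theta> - quantile_family d q \<Theta> D \<theta>) \<le> \<alpha>}
         \<ge> 1 - real (card (grid R \<alpha>)) ^ card \<Theta> * exp (- (\<epsilon> / 2) * (real n * \<eta>))"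
proof -
  let ?Q = "dir_quantile d q D"
  let ?loss = "\<lambda>v \<theta>. quantile_loss (3 * \<alpha> / 4) (real n * q) (sample_count n d X \<theta>) (v \<theta>)"
  let ?S = "{v \<in> space (PiM \<Theta> (\<lambda>_. borel)). linf_norm \<Theta> (\<lambda>\<theta>. v \<theta> - quantile_family d q \<Theta> D \<theta>) \<le> \<alpha>}"
  have low: "sample_count n d X \<theta> (?Q \<theta> - \<alpha> / 4) \<le> real n * q - real n * \<eta>"
    and high: "real n * q + real n * \<eta> \<le> sample_count n d X \<theta> (?Q \<theta> + \<alpha> / 4)" if "\<theta> \<in> \<Theta>" for \<theta>
    using X that by (auto simp: typical_samples_def)
  have n\<eta>: "real n * \<eta> \<ge> 0"
    using \<eta> by simp
  (* g rounds the true quantiles to the grid *)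
  obtain g where g: "\<And>\<theta>. \<theta> \<in> \<Theta> \<Longrightarrow> g \<theta> \<in> grid R \<alpha>" "\<And>\<theta>. \<theta> \<in> \<Theta> \<Longrightarrow> \<bar>g \<theta> - ?Q \<theta>\<bar> \<le> \<alpha> / 2"
    using grid_near[OF \<alpha> Q] by metis
  have zero: "?loss (restrict g \<Theta>) \<theta> = 0" if \<theta>: "\<theta> \<in> \<Theta>" for \<theta>
    by (rule quantile_loss_eq_0[OF mono_sample_count, where Q = "?Q \<theta>" and \<delta> = "\<alpha> / 4"])
       (use low[OF \<theta>] high[OF \<theta>] n\<eta> g(2)[OF \<theta>] \<theta> in auto)
  have far: "real n * \<eta> \<le> joint_loss n d q (3 * \<alpha> / 4) \<Theta> X v"
    if v: "v \<in> candidates R \<alpha> \<Theta>" "v \<notin> ?S" for v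
  proof -
    obtain \<theta> where \<theta>: "\<theta> \<in> \<Theta>" and dist: "\<alpha> < \<bar>v \<theta> - ?Q \<theta>\<bar>"
      using v candidates(3)[OF \<Theta>(1), of R \<alpha>]
      by (auto simp: linf_norm_le_iff[OF \<Theta>] quantile_family_def not_le)
    have "real n * \<eta> \<le> ?loss v \<theta>"
      by (rule quantile_loss_ge[OF mono_sample_count low[OF \<theta>] high[OF \<theta>]]) (use dist in auto)
    also have "\<dots> \<le> joint_loss n d q (3 * \<alpha> / 4) \<Theta> X v"
      unfolding joint_loss_def using \<Theta> \<theta> by (intro Max_ge) auto
    finally show ?thesis .
  qed
  have "measure (quantile_mechanism \<epsilon> n d q R \<alpha> \<Theta> X) ?S
      \<ge> 1 - real (card (candidates R \<alpha> \<Theta>)) * exp (- (\<epsilon> / 2) * (real n * \<eta>))"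
    unfolding quantile_mechanism_def
  proof (rule exp_mechanism_accurate[OF candidates(1-3)[OF \<Theta>(1)]])
    show "restrict g \<Theta> \<in> candidates R \<alpha> \<Theta>"
      using g(1) by (auto simp: candidates_def)
    show "joint_loss n d q (3 * \<alpha> / 4) \<Theta> X (restrict g \<Theta>) \<le> 0"
      unfolding joint_loss_def using \<Theta> zero by simp
  qed (use \<epsilon> far sets_linf_ball[OF \<Theta>(1)] in auto)
  then show ?thesis
    by (simp add: candidates(4)[OF \<Theta>(1)])
qed

text \<open>The sampling error and the randomness of the mechanism each get a failure probability of 1/20,
  and \<open>(19/20)\<^sup>2 > 9/10\<close>.\<close>

lemma quantile_mechanism_accurate:
  assumes D: "D \<in> admissible P d q R Rmin r L" and q: "0 < q" "q < 1" and L: "L > 0"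
    and \<alpha>: "0 < \<alpha>" "\<alpha> / 4 \<le> r" and \<epsilon>: "\<epsilon> \<ge> 0" and n: "n > 0"
    and \<Theta>: "finite \<Theta>" "\<Theta> \<noteq> {}" "\<Theta> \<subseteq> unit_sphere d"
    and sampling: "2 * real (card \<Theta>) * exp (- real n * (L * \<alpha>)\<^sup>2 / 32) \<le> 1 / 20"
    and selection: "real (card (grid R \<alpha>)) ^ card \<Theta> * exp (- \<epsilon> * real n * L * \<alpha> / 16) \<le> 1 / 20"
  shows "measure (PiM {..<n} (\<lambda>_. D) \<bind> quantile_mechanism \<epsilon> n d q R \<alpha> \<Theta>)
           {v \<in> space (PiM \<Theta> (\<lambda>_. borel)). linf_norm \<Theta> (\<lambda>\<theta>. v \<theta> - quantile_family d q \<Theta> D \<theta>) \<le> \<alpha>}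
         \<ge> 0.9"
proof -
  let ?M = "PiM {..<n} (\<lambda>_. D)" and ?K = "quantile_mechanism \<epsilon> n d q R \<alpha> \<Theta>"
  let ?S = "{v \<in> space (PiM \<Theta> (\<lambda>_. borel)). linf_norm \<Theta> (\<lambda>\<theta>. v \<theta> - quantile_family d q \<Theta> D \<theta>) \<le> \<alpha>}"
  let ?E = "typical_samples n d q (\<alpha> / 4) (L * (\<alpha> / 4) / 2) \<Theta> D"
  have prob: "prob_space D" and sets: "sets D = sets (Rd d)"
    and Q: "\<And>\<theta>. \<theta> \<in> \<Theta> \<Longrightarrow> dir_quantile d q D \<theta> \<in> {-R..R}"
    using D \<Theta> by (auto simp: admissible_def)
  have M: "?M \<in> space (prob_algebra (dataset n d))"
    unfolding space_prob_algebra dataset_def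
    using prob by (auto intro!: prob_space_PiM sets_PiM_cong simp: sets)
  have "(L * (\<alpha> / 4))\<^sup>2 / 2 = (L * \<alpha>)\<^sup>2 / 32"
    by (simp add: power_divide power_mult_distrib)
  then have rate: "- real n * (L * (\<alpha> / 4))\<^sup>2 / 2 = - real n * (L * \<alpha>)\<^sup>2 / 32"
    by (metis times_divide_eq_right)
  have E: "19 / 20 \<le> measure ?M ?E"
    using typical_samples_probability[OF D q L _ \<alpha>(2) n \<Theta>(1,3)] \<alpha>(1) sampling
    unfolding rate by simp
  have K: "19 / 20 \<le> measure (?K X) ?S" if X: "X \<in> ?E" for X
  proof -
    have exponent: "- (\<epsilon> / 2) * (real n * (L * (\<alpha> / 4) / 2)) = - \<epsilon> * real n * L * \<alpha> / 16"
      by simp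
    have "0 \<le> L * (\<alpha> / 4) / 2"
      using L \<alpha>(1) by simp
    from quantile_mechanism_accurate_on_typical[OF \<Theta>(1,2) \<epsilon> \<alpha>(1) this Q X] show ?thesis
      using selection unfolding exponent by linarith
  qed
  have "9 / 10 \<le> 19 / 20 * (19 / 20 :: real)"
    by simp
  also have "\<dots> \<le> measure ?M ?E * (19 / 20)"
    using E by (intro mult_right_mono) auto
  also have "\<dots> \<le> measure (?M \<bind> ?K) ?S"
    by (intro measure_bind_ge_mult[OF M quantile_mechanism_algorithm[OF \<Theta>(1), unfolded rand_algorithm_def]]
          sets_typical_samples sets \<Theta> sets_linf_ball K) auto
  finally show ?thesis
    by simp
qed

section \<open>The sample size\<close>

text \<open>Each summand \<open>x + 1/x\<close> bounds both \<open>x\<close> and \<open>1/x\<close>; those of \<open>d\<close> and \<open>M\<close> are at least 1.\<close>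

lemma param_sum_bounds:
  assumes "d \<ge> 1" "M \<ge> 1" and pos: "0 < q" "0 < Rmax" "0 < Rmin" "0 < r" "0 < L" "0 < \<epsilon>" "0 < \<alpha>"
  defines "s \<equiv> param_sum d M q Rmax Rmin r L \<epsilon> \<alpha>"
  shows "2 \<le> s" "real M \<le> s" "Rmax \<le> s" "1 / \<alpha> \<le> s"
proof -
  have "real d \<ge> 1" "real M \<ge> 1" "1 / real d > 0" "1 / real M > 0" "1 / q > 0" "1 / Rmax > 0"
    "1 / Rmin > 0" "1 / r > 0" "1 / L > 0" "1 / \<epsilon> > 0" "1 / \<alpha> > 0"
    using assms by auto
  moreover have "s = real d + 1 / real d + (real M + 1 / real M) + (q + 1 / q) + (Rmax + 1 / Rmax)
      + (Rmin + 1 / Rmin) + (r + 1 / r) + (L + 1 / L) + (\<epsilon> + 1 / \<epsilon>) + (\<alpha> + 1 / \<alpha>)"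
    by (simp add: s_def param_sum_def)
  ultimately show "2 \<le> s" "real M \<le> s" "Rmax \<le> s" "1 / \<alpha> \<le> s"
    using pos by linarith+
qed

text \<open>The numbers \<open>a\<close> and \<open>b\<close> below are the thresholds at which the two exponential bounds drop to
  1/20. Every logarithm in them is that of a quantity at most a fixed power of \<open>2 + s\<close>, where \<open>s\<close> is
  the sum of the parameters, and so is a bounded multiple of \<open>l = ln (2 + s) \<ge> 1\<close>. Rounding \<open>a + b\<close> up
  at most doubles it, unless the result is 1. The constant 448 is
  \<open>2 (128 + 96)\<close>, from the bounds \<open>a \<le> 128 l x\<close> and \<open>b \<le> 96 l y\<close> in terms of the first two terms
  \<open>x\<close> and \<open>y\<close> of the rate.\<close>

lemma sample_size:
  assumes dM: "d \<ge> 1" "M \<ge> 1" and pos: "0 < q" "0 < Rmax" "0 < Rmin" "0 < r" "0 < L" "0 < \<epsilon>" "0 < \<alpha>"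
  obtains n :: nat where "n > 0"
    "soft_O 448 (param_sum d M q Rmax Rmin r L \<epsilon> \<alpha>) n (sample_rate d M Rmin r L \<epsilon> \<alpha>)"
    "2 * real M * exp (- real n * (L * \<alpha>)\<^sup>2 / 32) \<le> 1 / 20"
    "real (card (grid Rmax \<alpha>)) ^ M * exp (- \<epsilon> * real n * L * \<alpha> / 16) \<le> 1 / 20"
proof -
  define s where "s = param_sum d M q Rmax Rmin r L \<epsilon> \<alpha>"
  define l where "l = ln (2 + s)"
  define K where "K = card (grid Rmax \<alpha>)"
  define a where "a = 32 * ln (40 * real M) / (L * \<alpha>)\<^sup>2"
  define b where "b = 16 * (real M * ln (real K) + ln 20) / (\<epsilon> * L * \<alpha>)"
  define n where "n = nat \<lceil>a + b\<rceil>"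
  note s = param_sum_bounds[OF dM pos, folded s_def]
  have K1: "K \<ge> 1"
    unfolding K_def using finite_grid grid_nonempty by (simp add: Suc_le_eq card_gt_0_iff)
  have a: "a > 0"
    unfolding a_def using dM pos by (intro divide_pos_pos mult_pos_pos ln_gt_zero) auto
  have b: "b > 0"
    unfolding b_def using K1 dM pos
    by (intro divide_pos_pos mult_pos_pos add_nonneg_pos mult_nonneg_nonneg ln_gt_zero ln_ge_zero) auto
  have n: "n > 0" "a \<le> real n" "b \<le> real n" "real n \<le> a + b + 1"
    using a b unfolding n_def by linarith+

  have "2 * real M * exp (- real n * (L * \<alpha>)\<^sup>2 / 32) \<le> 2 * real M * exp (- ln (40 * real M))"
  proof -
    have "a * (L * \<alpha>)\<^sup>2 \<le> real n * (L * \<alpha>)\<^sup>2"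
      using n by (intro mult_right_mono) auto
    moreover have "a * (L * \<alpha>)\<^sup>2 = 32 * ln (40 * real M)"
      using pos by (simp add: a_def)
    ultimately show ?thesis
      by (intro mult_left_mono) auto
  qed
  also have "\<dots> = 1 / 20"
    using dM by (simp add: exp_minus)
  finally have sampling: "2 * real M * exp (- real n * (L * \<alpha>)\<^sup>2 / 32) \<le> 1 / 20" .

  have "real K ^ M * exp (- \<epsilon> * real n * L * \<alpha> / 16) \<le> real K ^ M * exp (- (real M * ln (real K) + ln 20))"
  proof -
    have "b * (\<epsilon> * L * \<alpha>) \<le> real n * (\<epsilon> * L * \<alpha>)"
      using n pos by (intro mult_right_mono) auto
    moreover have "b * (\<epsilon> * L * \<alpha>) = 16 * (real M * ln (real K) + ln 20)"
      using pos by (simp add: b_def)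
    ultimately show ?thesis
      by (intro mult_left_mono) (auto simp: mult_ac)
  qed
  also have "\<dots> = 1 / 20"
  proof -
    have "exp (real M * ln (real K)) = real K ^ M"
      using K1 by (simp add: exp_of_nat_mult)
    then show ?thesis
      using K1 by (simp add: exp_minus exp_diff)
  qed
  finally have selection: "real K ^ M * exp (- \<epsilon> * real n * L * \<alpha> / 16) \<le> 1 / 20" .

  have l: "l \<ge> 1"
  proof -
    have "exp 1 \<le> 2 + s"
      using exp_le s by linarith
    then show ?thesis
      unfolding l_def using s by (subst ln_ge_iff) auto
  qed
  (* bounds each logarithm in a and b through a power of 2 + s that exceeds its argument *)
  have l_ge: "ln x \<le> real k * l" if "0 < x" "x \<le> (2 + s) ^ k" for x k
  proof -
    have "ln x \<le> ln ((2 + s) ^ k)"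
      using that s by (subst ln_le_cancel_iff) auto
    then show ?thesis
      using s by (simp add: l_def ln_realpow)
  qed
  have pow: "4 ^ k \<le> (2 + s) ^ k" for k :: nat
    using s by (intro power_mono) auto
  have "ln (40 * real M) \<le> real 4 * l"
  proof (rule l_ge)
    have "40 * real M \<le> (2 + s) ^ 3 * (2 + s)"
      using pow[of 3] s by (intro mult_mono) auto
    then show "40 * real M \<le> (2 + s) ^ 4"
      by (simp add: eval_nat_numeral mult_ac)
  qed (use dM in auto)
  moreover have "ln 20 \<le> real 3 * l"
    using pow[of 3] by (intro l_ge) auto
  moreover have "ln (real K) \<le> real 3 * l"
  proof (rule l_ge)
    have "real K \<le> 2 * (Rmax * (1 / \<alpha>)) + 2"
      unfolding K_def using card_grid_le[of Rmax \<alpha>] pos by simp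
    also have "Rmax * (1 / \<alpha>) \<le> s * s"
      using s pos by (intro mult_mono) auto
    also have "2 * (s * s) + 2 \<le> (2 + s) ^ 2 * (2 + s)"
      using s by (simp add: power2_eq_square algebra_simps)
    finally show "real K \<le> (2 + s) ^ 3"
      by (simp add: eval_nat_numeral mult_ac)
  qed (use K1 in auto)
  ultimately have lnM: "ln (40 * real M) \<le> 4 * l" and lnK: "ln (real K) \<le> 3 * l" and ln20: "ln 20 \<le> 3 * l"
    by simp_all
  define x y z where "x = real d / (\<alpha>\<^sup>2 * L\<^sup>2)" and "y = real M / (\<epsilon> * L * \<alpha>)"
    and "z = real M / (\<epsilon> * L * min r Rmin)"
  define g where "g = x + y + z"
  have rate: "sample_rate d M Rmin r L \<epsilon> \<alpha> = g"
    by (simp add: sample_rate_def g_def x_def y_def z_def)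
  have xyz: "x \<ge> 0" "y \<ge> 0" "z \<ge> 0"
    using pos by (auto simp: x_def y_def z_def)
  have "a \<le> 32 * (4 * l) / (L * \<alpha>)\<^sup>2"
    unfolding a_def using lnM by (intro divide_right_mono mult_left_mono) auto
  also have "\<dots> = 128 * l * (1 / (\<alpha>\<^sup>2 * L\<^sup>2))"
    by (simp add: power_mult_distrib mult.commute)
  also have "\<dots> \<le> 128 * l * x"
    unfolding x_def using l dM by (intro mult_left_mono divide_right_mono) auto
  finally have a_le: "a \<le> 128 * l * x" .
  have "real M * ln (real K) + ln 20 \<le> real M * (3 * l) + 1 * (3 * l)"
    using lnK ln20 by (intro add_mono mult_left_mono) auto
  also have "1 * (3 * l) \<le> real M * (3 * l)"
    using l dM by (intro mult_right_mono) auto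
  finally have "real M * ln (real K) + ln 20 \<le> 6 * l * real M"
    by simp
  then have "b \<le> 16 * (6 * l * real M) / (\<epsilon> * L * \<alpha>)"
    unfolding b_def using pos by (intro divide_right_mono mult_left_mono) auto
  then have b_le: "b \<le> 96 * l * y"
    by (simp add: y_def)
  have "0 \<le> l * x" "0 \<le> l * y" "0 \<le> l * z"
    using l xyz by auto
  then have ab: "2 * (a + b) \<le> 448 * (g * l)"
    unfolding g_def using a_le b_le by (simp add: algebra_simps)
  have g: "g \<ge> 0"
    using xyz by (simp add: g_def)
  have l_powr: "l \<le> l powr 448"
    using l powr_mono[of 1 448 l] by simp
  have "real n \<le> max 1 (448 * g * l powr 448)"
  proof (cases "a + b \<le> 1")
    case True
    then have "n \<le> 1"
      unfolding n_def by linarith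
    then show ?thesis
      by simp
  next
    case False
    then have "a + b + 1 \<le> 2 * (a + b)"
      by simp
    then have "real n \<le> 448 * (g * l)"
      by (rule order_trans[OF order_trans[OF n(4)] ab])
    also have "\<dots> \<le> 448 * (g * l powr 448)"
      using g l_powr by (intro mult_left_mono) auto
    finally show ?thesis
      by simp
  qed
  then have "soft_O 448 s n g"
    by (simp add: soft_O_def l_def)
  then show ?thesis
    using that[of n] n(1) sampling selection by (simp add: s_def rate K_def)
qed

theorem corollary12:
  fixes P :: "real poly poly"
  shows "\<exists>C\<ge>1. \<forall>(d::nat) (M::nat) (q::real) (Rmax::real) (Rmin::real) (r::real) (L::real) (\<epsilon>::real)
           (\<Theta> :: (nat \<Rightarrow> real) set) (\<alpha>::real).
     d \<ge> 1 \<longrightarrow> M \<ge> 1 \<longrightarrow> 0 < q \<longrightarrow> q < 1 \<longrightarrow> Rmax > 0 \<longrightarrow> Rmin > 0 \<longrightarrow> r > 0 \<longrightarrow> L > 0 \<longrightarrow> \<epsilon> > 0 \<longrightarrow>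
     \<Theta> \<subseteq> unit_sphere d \<longrightarrow> card \<Theta> = M \<longrightarrow> 0 < \<alpha> \<longrightarrow> \<alpha> < min r Rmin / 2 \<longrightarrow>
     (\<exists>(n::nat) (\<A> :: (nat \<Rightarrow> nat \<Rightarrow> real) \<Rightarrow> ((nat \<Rightarrow> real) \<Rightarrow> real) measure).
        n > 0 \<and>
        soft_O C (param_sum d M q Rmax Rmin r L \<epsilon> \<alpha>) n (sample_rate d M Rmin r L \<epsilon> \<alpha>) \<and>
        rand_algorithm n d (PiM \<Theta> (\<lambda>_. borel)) \<A> \<and>
        diff_private \<epsilon> n d (PiM \<Theta> (\<lambda>_. borel)) \<A> \<and>
        (\<forall>D \<in> admissible P d q Rmax Rmin r L.
           measure (PiM {..<n} (\<lambda>_. D) \<bind> \<A>)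
             {v \<in> space (PiM \<Theta> (\<lambda>_. borel)).
                linf_norm \<Theta> (\<lambda>\<theta>. v \<theta> - quantile_family d q \<Theta> D \<theta>) \<le> \<alpha>} \<ge> 0.9))"
proof (intro exI[of _ "448::real"] conjI allI impI)
  fix d M :: nat and q Rmax Rmin r L \<epsilon> \<alpha> :: real and \<Theta> :: "(nat \<Rightarrow> real) set"
  assume dM: "d \<ge> 1" "M \<ge> 1" and q: "0 < q" "q < 1"
    and pos: "Rmax > 0" "Rmin > 0" "r > 0" "L > 0" "\<epsilon> > 0"
    and \<Theta>: "\<Theta> \<subseteq> unit_sphere d" "card \<Theta> = M" and \<alpha>: "0 < \<alpha>" "\<alpha> < min r Rmin / 2"
  have fin: "finite \<Theta>" "\<Theta> \<noteq> {}"
    using \<Theta> dM by (auto intro: card_ge_0_finite)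
  obtain n :: nat where n: "n > 0"
    "soft_O 448 (param_sum d M q Rmax Rmin r L \<epsilon> \<alpha>) n (sample_rate d M Rmin r L \<epsilon> \<alpha>)"
    "2 * real M * exp (- real n * (L * \<alpha>)\<^sup>2 / 32) \<le> 1 / 20"
    "real (card (grid Rmax \<alpha>)) ^ M * exp (- \<epsilon> * real n * L * \<alpha> / 16) \<le> 1 / 20"
    using sample_size[OF dM q(1) pos \<alpha>(1)] by blast
  show "\<exists>n \<A>. n > 0 \<and>
        soft_O 448 (param_sum d M q Rmax Rmin r L \<epsilon> \<alpha>) n (sample_rate d M Rmin r L \<epsilon> \<alpha>) \<and>
        rand_algorithm n d (PiM \<Theta> (\<lambda>_. borel)) \<A> \<and>
        diff_private \<epsilon> n d (PiM \<Theta> (\<lambda>_. borel)) \<A> \<and>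
        (\<forall>D \<in> admissible P d q Rmax Rmin r L.
           measure (PiM {..<n} (\<lambda>_. D) \<bind> \<A>)
             {v \<in> space (PiM \<Theta> (\<lambda>_. borel)).
                linf_norm \<Theta> (\<lambda>\<theta>. v \<theta> - quantile_family d q \<Theta> D \<theta>) \<le> \<alpha>} \<ge> 0.9)"
  proof (intro exI[of _ n] exI[of _ "quantile_mechanism \<epsilon> n d q Rmax \<alpha> \<Theta>"] conjI ballI n)
    show "rand_algorithm n d (PiM \<Theta> (\<lambda>_. borel)) (quantile_mechanism \<epsilon> n d q Rmax \<alpha> \<Theta>)"
      by (rule quantile_mechanism_algorithm[OF fin(1)])
    show "diff_private \<epsilon> n d (PiM \<Theta> (\<lambda>_. borel)) (quantile_mechanism \<epsilon> n d q Rmax \<alpha> \<Theta>)"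
      using pos by (intro quantile_mechanism_private fin) auto
    fix D assume D: "D \<in> admissible P d q Rmax Rmin r L"
    show "measure (PiM {..<n} (\<lambda>_. D) \<bind> quantile_mechanism \<epsilon> n d q Rmax \<alpha> \<Theta>)
             {v \<in> space (PiM \<Theta> (\<lambda>_. borel)).
                linf_norm \<Theta> (\<lambda>\<theta>. v \<theta> - quantile_family d q \<Theta> D \<theta>) \<le> \<alpha>} \<ge> 0.9"
      by (rule quantile_mechanism_accurate[OF D]) (use q pos \<alpha> n fin \<Theta> in auto)
  qed
qed simp

end
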